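(* Let $K=\mathbb{R}$ or $K=\mathbb{C}$, $n\in\mathbb{Z}_{>0}$, and let $\varphi^{[n]}:\mathbb{R}^n\to K$ be an $n$-dimensional tensor product mother scaling function, with associated spaces $V_j$, $j\in\mathbb{Z}$. Then $$\bigcap_{j\in\mathbb{Z}}V_j=K,$$ where $K$ on the right-hand side denotes the set of all $K$-valued constant functions on $\mathbb{R}^n$.
   Context: $\varphi:\mathbb{R}\to K$ is a compactly supported interpolating mother scaling function: it is continuous and compactly supported, $\varphi(k)=\delta_{k,0}$ for all $k\in\mathbb{Z}$, and $\varphi(x)=\sum_{k\in\mathbb{Z}}\varphi(k/2)\varphi(2x-k)$ for all $x\in\mathbb{R}$. The $n$-dimensional tensor product mother scaling function generated by $\varphi$ is $\varphi^{[n]}(x)=\prod_{i=1}^n\varphi(x_i)$, $x\in\mathbb{R}^n$. For $j\in\mathbb{Z}$, $$V_j=\Bigl\{x\mapsto\sum_{k\in\mathbb{Z}^n}a_k\,\varphi^{[n]}(2^jx-k)\ :\ (a_k)_{k}\in\ell^\infty(\mathbb{Z}^n,K)\Bigr\}$$ (the sum is pointwise, with finitely many nonzero terms at each $x$). *)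

theory Defs
  imports "HOL-Analysis.Analysis"
begin

text \<open>The scalar type is kept polymorphic here only so that the same definitions serve
  both \<open>K = \<real>\<close> (type \<open>real\<close>) and \<open>K = \<complex>\<close> (type \<open>complex\<close>).\<close>

definition interpolating_mother_scaling :: "(real \<Rightarrow> 'k::real_normed_field) \<Rightarrow> bool" where
  "interpolating_mother_scaling \<phi> \<longleftrightarrow>
     continuous_on UNIV \<phi> \<and>
     compact (closure {x. \<phi> x \<noteq> 0}) \<and>
     (\<forall>k::int. \<phi> (of_int k) = (if k = 0 then 1 else 0)) \<and>
     (\<forall>x::real. \<phi> x = (\<Sum>\<^sub>\<infinity>k::int. \<phi> (of_int k / 2) * \<phi> (2 * x - of_int k)))"

definition tensor_power :: "(real \<Rightarrow> 'k::real_normed_field) \<Rightarrow> real ^ 'n::finite \<Rightarrow> 'k" where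
  "tensor_power \<phi> x = (\<Prod>i\<in>UNIV. \<phi> (x $ i))"

definition int_vec :: "int ^ 'n::finite \<Rightarrow> real ^ 'n" where
  "int_vec k = (\<chi> i. of_int (k $ i))"

text \<open>The coefficient family ranges over \<open>\<ell>\<^sup>\<infinity>(\<int>\<^sup>n, K)\<close>. For \<open>\<Phi>\<close> of compact support
  only finitely many terms of the sum are nonzero at each \<open>x\<close>, so the unconditional
  sum is then a finite one; the same holds for the refinement equation above.\<close>

definition scaling_space ::
    "(real ^ 'n::finite \<Rightarrow> 'k::real_normed_field) \<Rightarrow> int \<Rightarrow> (real ^ 'n \<Rightarrow> 'k) set" where
  "scaling_space \<Phi> j =
     {(\<lambda>x. \<Sum>\<^sub>\<infinity>k. a k * \<Phi> ((2 powi j) *\<^sub>R x - int_vec k)) | a. bounded (range a)}"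

end

theory Submission
  imports Defs
begin

text \<open>
  The two inclusions come from one rescaling idea, used once at fine and once at coarse scales.

  \<^emph>\<open>Constants lie in every space.\<close> Since \<open>\<phi>\<close> interpolates, iterating the refinement equation
  \<open>n\<close> times reproduces \<open>\<phi>\<close> from its own samples:
  \<open>\<phi> x = (\<Sum>k. \<phi> (k / 2^n) * \<phi> (2^n * x - k))\<close>. At \<open>x = t / 2^n\<close> the functions on the right no
  longer depend on \<open>n\<close>, while all samples involved, and the left-hand side, tend to \<open>\<phi> 0 = 1\<close>.
  Hence the integer translates of \<open>\<phi>\<close> sum to one (\<open>sum_translates_eq_1\<close>), so do those of its
  tensor power (\<open>tensor_partition_of_unity\<close>), and a constant coefficient family represents a
  constant function.

  \<^emph>\<open>Nothing else lies in all of them.\<close> The coefficients of a member \<open>f\<close> of the \<open>j\<close>-th space are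
  its samples on the lattice of mesh \<open>2 powi (-j)\<close> (\<open>coefficient_eq_sample\<close>). For \<open>j = -m\<close> these
  lattices are contained in the integer lattice, so the coefficients are bounded uniformly in
  \<open>m\<close> by those of \<open>f\<close> in the \<open>0\<close>-th space. As \<open>m\<close> grows, the rescaled argument \<open>2 powi (-m) * x\<close>
  tends to \<open>0\<close>, where every translate of the tensor power vanishes except the unshifted one,
  whose coefficient is \<open>f 0\<close>. Therefore \<open>f x = f 0\<close> (\<open>in_all_scaling_spaces_constant\<close>).
\<close>

section \<open>Consequences of compact support\<close>

lemma interpolating_support_bound:
  assumes "interpolating_mother_scaling \<phi>"
  obtains R :: real where "R \<ge> 0" "\<And>x. \<phi> x \<noteq> 0 \<Longrightarrow> \<bar>x\<bar> \<le> R"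
proof -
  have "bounded (closure {x. \<phi> x \<noteq> 0})"
    using assms compact_imp_bounded unfolding interpolating_mother_scaling_def by blast
  then obtain R where R: "\<forall>x\<in>closure {x. \<phi> x \<noteq> 0}. norm x \<le> R"
    unfolding bounded_iff by blast
  have "\<bar>x\<bar> \<le> max R 0" if "\<phi> x \<noteq> 0" for x
    using R that closure_subset[of "{x. \<phi> x \<noteq> 0}"] by force
  then show ?thesis
    by (intro that[of "max R 0"]) auto
qed

lemma finite_translates:
  assumes "interpolating_mother_scaling \<phi>"
  shows "finite {k::int. \<phi> (y - of_int k) \<noteq> 0}"
proof -
  obtain R where R: "\<And>x. \<phi> x \<noteq> 0 \<Longrightarrow> \<bar>x\<bar> \<le> R"
    using interpolating_support_bound[OF assms] by blast
  have "{k::int. \<phi> (y - of_int k) \<noteq> 0} \<subseteq> {\<lceil>y - R\<rceil>..\<lfloor>y + R\<rfloor>}"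
  proof
    fix k :: int assume "k \<in> {k. \<phi> (y - of_int k) \<noteq> 0}"
    then have "\<bar>y - of_int k\<bar> \<le> R" using R by blast
    then have "y - R \<le> of_int k" "of_int k \<le> y + R" by linarith+
    then show "k \<in> {\<lceil>y - R\<rceil>..\<lfloor>y + R\<rfloor>}"
      by (simp add: ceiling_le_iff le_floor_iff)
  qed
  then show ?thesis using finite_subset by blast
qed

section \<open>Partition of unity\<close>

lemma refinement_finite_sum:
  fixes \<phi> :: "real \<Rightarrow> 'k::real_normed_field"
  assumes \<phi>: "interpolating_mother_scaling \<phi>"
    and G: "finite G" "{m::int. \<phi> (2 * y - of_int m) \<noteq> 0} \<subseteq> G"
  shows "\<phi> (y - of_int k) = (\<Sum>m\<in>G. \<phi> (of_int m / 2 - of_int k) * \<phi> (2 * y - of_int m))"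
proof -
  have "\<phi> (y - of_int k)
      = (\<Sum>\<^sub>\<infinity>l::int. \<phi> (of_int l / 2) * \<phi> (2 * (y - of_int k) - of_int l))"
    using \<phi> unfolding interpolating_mother_scaling_def by blast
  also have "\<dots> = (\<Sum>\<^sub>\<infinity>m::int. \<phi> (of_int m / 2 - of_int k) * \<phi> (2 * y - of_int m))"
  proof (rule infsum_reindex_bij_witness[where i = "\<lambda>m. m - 2 * k" and j = "\<lambda>l. l + 2 * k"])
    fix l :: int
    show "\<phi> (of_int (l + 2 * k) / 2 - of_int k) * \<phi> (2 * y - of_int (l + 2 * k))
        = \<phi> (of_int l / 2) * \<phi> (2 * (y - of_int k) - of_int l)"
      by (simp add: add_divide_distrib algebra_simps)
  qed auto
  also have "\<dots> = (\<Sum>\<^sub>\<infinity>m\<in>G. \<phi> (of_int m / 2 - of_int k) * \<phi> (2 * y - of_int m))"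
    using G(2) by (intro infsum_cong_neutral) auto
  finally show ?thesis using G(1) by simp
qed

text \<open>The reason is interpolation: expanding each \<open>\<phi> (2^n * x - k)\<close> once more, the new
  coefficient of \<open>\<phi> (2^(n+1) * x - m)\<close> is the \<open>n\<close>-th formula evaluated at \<open>m / 2^(n+1)\<close>, hence
  again a sample. The index set \<open>F\<close> is left free because this step uses the formula at
  several points with one common index set.\<close>

lemma iterated_refinement:
  fixes \<phi> :: "real \<Rightarrow> 'k::real_normed_field"
  assumes \<phi>: "interpolating_mother_scaling \<phi>"
    and "finite F" "{k::int. \<phi> (2^n * x - of_int k) \<noteq> 0} \<subseteq> F"
  shows "\<phi> x = (\<Sum>k\<in>F. \<phi> (of_int k / 2^n) * \<phi> (2^n * x - of_int k))"
  using assms(2,3)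
proof (induction n arbitrary: x F)
  case 0
  have int: "\<phi> (of_int k) = (if k = 0 then 1 else 0)" for k :: int
    using \<phi> unfolding interpolating_mother_scaling_def by blast
  have "(\<Sum>k\<in>F. \<phi> (of_int k / 2^0) * \<phi> (2^0 * x - of_int k))
      = (\<Sum>k\<in>F. if k = 0 then \<phi> x else 0)"
    by (intro sum.cong) (auto simp: int)
  also have "\<dots> = \<phi> x" using 0 subsetD[OF 0(2), of 0] by auto
  finally show ?case by simp
next
  case (Suc n)
  define H where "H = {k::int. \<phi> (2^n * x - of_int k) \<noteq> 0}
      \<union> (\<Union>m\<in>F. {k::int. \<phi> (of_int m / 2 - of_int k) \<noteq> 0})"
  have H: "finite H"
    unfolding H_def using Suc.prems(1) finite_translates[OF \<phi>] by auto
  have sample: "\<phi> (of_int m / 2^Suc n)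
      = (\<Sum>k\<in>H. \<phi> (of_int k / 2^n) * \<phi> (of_int m / 2 - of_int k))" if "m \<in> F" for m
  proof -
    have e: "2^n * (of_int m / 2^Suc n) = (of_int m / 2 :: real)" by simp
    have "{k. \<phi> (2^n * (of_int m / 2^Suc n) - of_int k) \<noteq> 0} \<subseteq> H"
      unfolding e H_def using that by blast
    from Suc.IH[OF H this] show ?thesis unfolding e .
  qed
  have "\<phi> x = (\<Sum>k\<in>H. \<phi> (of_int k / 2^n) * \<phi> (2^n * x - of_int k))"
    by (rule Suc.IH[OF H]) (auto simp: H_def)
  also have "\<dots> = (\<Sum>k\<in>H. \<phi> (of_int k / 2^n) *
      (\<Sum>m\<in>F. \<phi> (of_int m / 2 - of_int k) * \<phi> (2^Suc n * x - of_int m)))"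
  proof (intro sum.cong refl arg_cong2[where f = "(*)"])
    fix k
    have e: "2 * (2^n * x) = 2^Suc n * x" by simp
    show "\<phi> (2^n * x - of_int k)
        = (\<Sum>m\<in>F. \<phi> (of_int m / 2 - of_int k) * \<phi> (2^Suc n * x - of_int m))"
      using refinement_finite_sum[OF \<phi> Suc.prems(1), of "2^n * x" k] Suc.prems(2)
      unfolding e by blast
  qed
  also have "\<dots> = (\<Sum>m\<in>F. (\<Sum>k\<in>H. \<phi> (of_int k / 2^n) * \<phi> (of_int m / 2 - of_int k))
      * \<phi> (2^Suc n * x - of_int m))"
    unfolding sum_distrib_left sum_distrib_right
    by (subst sum.swap) (simp only: mult.assoc)
  also have "\<dots> = (\<Sum>m\<in>F. \<phi> (of_int m / 2^Suc n) * \<phi> (2^Suc n * x - of_int m))"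
    by (intro sum.cong refl) (simp only: sample)
  finally show ?case .
qed

text \<open>Both sides of \<open>\<phi> (t / 2^n) = (\<Sum>k\<in>F. \<phi> (k / 2^n) * \<phi> (t - k))\<close> converge as \<open>n\<close> grows, by
  continuity of \<open>\<phi>\<close> at \<open>0\<close>.\<close>

lemma sum_translates_eq_1:
  fixes \<phi> :: "real \<Rightarrow> 'k::real_normed_field"
  assumes \<phi>: "interpolating_mother_scaling \<phi>"
    and F: "finite F" "{k::int. \<phi> (t - of_int k) \<noteq> 0} \<subseteq> F"
  shows "(\<Sum>k\<in>F. \<phi> (t - of_int k)) = 1"
proof -
  have cont: "isCont \<phi> 0"
    using \<phi> unfolding interpolating_mother_scaling_def
    by (meson UNIV_I continuous_on_eq_continuous_at open_UNIV)
  have "\<phi> (of_int 0) = (if (0::int) = 0 then 1 else 0)"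
    using \<phi> unfolding interpolating_mother_scaling_def by blast
  then have zero: "\<phi> 0 = 1" by simp
  have "(\<lambda>n. c / 2^n) \<longlonglongrightarrow> 0" for c :: real
    using tendsto_mult_right_zero[OF LIMSEQ_power_zero[of "1/2::real"], of c]
    by (simp add: power_one_over field_simps)
  then have lim: "(\<lambda>n. \<phi> (c / 2^n)) \<longlonglongrightarrow> 1" for c :: real
    using isCont_tendsto_compose[OF cont] zero by metis
  have "(\<lambda>n. \<Sum>k\<in>F. \<phi> (of_int k / 2^n) * \<phi> (t - of_int k)) \<longlonglongrightarrow> (\<Sum>k\<in>F. 1 * \<phi> (t - of_int k))"
    by (intro tendsto_intros lim)
  moreover have "(\<Sum>k\<in>F. \<phi> (of_int k / 2^n) * \<phi> (t - of_int k)) = \<phi> (t / 2^n)" for n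
    using iterated_refinement[OF \<phi> F(1), of n "t / 2^n"] F(2) by simp
  ultimately have "(\<lambda>n. \<phi> (t / 2^n)) \<longlonglongrightarrow> (\<Sum>k\<in>F. \<phi> (t - of_int k))" by simp
  then show ?thesis using lim LIMSEQ_unique by blast
qed

text \<open>The sum over \<open>\<int>\<^sup>n\<close> factors into \<open>n\<close> one-dimensional sums by distributivity, once the
  coordinates are restricted to finite sets.\<close>

lemma tensor_partition_of_unity:
  fixes \<phi> :: "real \<Rightarrow> 'k::real_normed_field" and y :: "real ^ 'n::finite"
  assumes \<phi>: "interpolating_mother_scaling \<phi>"
  shows "(\<Sum>\<^sub>\<infinity>k. tensor_power \<phi> (y - int_vec k)) = 1"
proof -
  define B where "B i = {k::int. \<phi> (y $ i - of_int k) \<noteq> 0}" for i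
  have B: "finite (B i)" for i
    unfolding B_def by (rule finite_translates[OF \<phi>])
  have fin: "finite (PiE (UNIV :: 'n set) B)" using B by (intro finite_PiE) auto
  have inj: "inj_on vec_lambda (PiE (UNIV :: 'n set) B)"
    by (rule inj_onI) (simp add: vec_lambda_inject)
  have "(\<Sum>\<^sub>\<infinity>k. tensor_power \<phi> (y - int_vec k))
      = (\<Sum>\<^sub>\<infinity>k\<in>vec_lambda ` PiE UNIV B. tensor_power \<phi> (y - int_vec k))"
  proof (rule infsum_cong_neutral)
    fix k assume k: "k \<in> UNIV - vec_lambda ` PiE UNIV B"
    have "\<exists>i. k $ i \<notin> B i"
    proof (rule ccontr)
      assume "\<not> ?thesis"
      then have "vec_nth k \<in> PiE UNIV B" by auto
      then have "vec_lambda (vec_nth k) \<in> vec_lambda ` PiE UNIV B" by (rule imageI)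
      then show False using k by simp
    qed
    then show "tensor_power \<phi> (y - int_vec k) = 0"
      by (auto simp: tensor_power_def int_vec_def B_def)
  qed auto
  also have "\<dots> = (\<Sum>g\<in>PiE UNIV B. tensor_power \<phi> (y - int_vec (vec_lambda g)))"
    using fin inj by (simp add: sum.reindex)
  also have "\<dots> = (\<Sum>g\<in>PiE UNIV B. \<Prod>i\<in>UNIV. \<phi> (y $ i - of_int (g i)))"
    by (simp add: tensor_power_def int_vec_def)
  also have "\<dots> = (\<Prod>i\<in>UNIV. \<Sum>k\<in>B i. \<phi> (y $ i - of_int k))"
    using B by (subst prod_sum_PiE) auto
  also have "\<dots> = 1"
    using sum_translates_eq_1[OF \<phi> B] by (simp add: B_def)
  finally show ?thesis .
qed

lemma constant_in_scaling_space:
  fixes \<phi> :: "real \<Rightarrow> 'k::real_normed_field"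
  assumes "interpolating_mother_scaling \<phi>"
  shows "(\<lambda>x. c) \<in> scaling_space (tensor_power \<phi> :: real ^ 'n::finite \<Rightarrow> 'k) j"
proof -
  have "(\<Sum>\<^sub>\<infinity>k. c * tensor_power \<phi> ((2 powi j) *\<^sub>R x - int_vec k)) = c" for x :: "real ^ 'n"
    by (simp add: infsum_cmult_right' tensor_partition_of_unity[OF assms])
  then show ?thesis
    unfolding scaling_space_def by (intro CollectI exI[of _ "\<lambda>_. c"]) auto
qed

section \<open>Functions common to all scales\<close>

lemma tensor_power_int_vec:
  fixes \<phi> :: "real \<Rightarrow> 'k::real_normed_field" and k :: "int ^ 'n::finite"
  assumes "interpolating_mother_scaling \<phi>"
  shows "tensor_power \<phi> (int_vec k) = (if k = 0 then 1 else 0)"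
proof -
  have "\<phi> (of_int m) = (if m = 0 then 1 else 0)" for m :: int
    using assms unfolding interpolating_mother_scaling_def by blast
  then show ?thesis by (auto simp: tensor_power_def int_vec_def vec_eq_iff)
qed

lemma int_vec_diff: "int_vec k - int_vec l = int_vec (k - l)"
  by (simp add: int_vec_def vec_eq_iff)

lemma coefficient_eq_sample:
  fixes \<phi> :: "real \<Rightarrow> 'k::real_normed_field" and l :: "int ^ 'n::finite"
  assumes \<phi>: "interpolating_mother_scaling \<phi>"
    and f: "\<And>x. f x = (\<Sum>\<^sub>\<infinity>k. a k * tensor_power \<phi> ((2 powi j) *\<^sub>R x - int_vec k))"
  shows "f ((2 powi (-j)) *\<^sub>R int_vec l) = a l"
proof -
  have "(2::real) powi j * 2 powi (-j) = 1" by (simp add: power_int_minus)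
  then have "f ((2 powi (-j)) *\<^sub>R int_vec l) = (\<Sum>\<^sub>\<infinity>k. a k * (if l - k = 0 then 1 else 0))"
    by (simp add: f int_vec_diff tensor_power_int_vec[OF \<phi>])
  also have "\<dots> = (\<Sum>\<^sub>\<infinity>k\<in>{l}. a k)"
    by (rule infsum_cong_neutral) auto
  finally show ?thesis by simp
qed

lemma continuous_tensor_power:
  fixes \<phi> :: "real \<Rightarrow> 'k::real_normed_field"
  assumes "interpolating_mother_scaling \<phi>"
  shows "isCont (tensor_power \<phi>) (z :: real ^ 'n::finite)"
proof -
  have "isCont \<phi> t" for t
    using assms unfolding interpolating_mother_scaling_def
    by (meson UNIV_I continuous_on_eq_continuous_at open_UNIV)
  then have "isCont (\<lambda>x. \<phi> (x $ i)) z" for i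
    by (intro isCont_o2[OF _ \<open>\<And>t. isCont \<phi> t\<close>] continuous_intros)
  then show ?thesis unfolding tensor_power_def by (intro continuous_prod) auto
qed

text \<open>Near the origin only the shifts from one fixed finite set matter, which is what allows
  the limit in \<open>in_all_scaling_spaces_constant\<close> to be taken term by term.\<close>

lemma finite_shifts_near_0:
  fixes \<phi> :: "real \<Rightarrow> 'k::real_normed_field"
  assumes \<phi>: "interpolating_mother_scaling \<phi>"
  obtains K :: "(int ^ 'n::finite) set" where "finite K" "0 \<in> K"
    "\<And>y k. norm y \<le> 1 \<Longrightarrow> k \<notin> K \<Longrightarrow> tensor_power \<phi> (y - int_vec k) = 0"
proof -
  obtain R where R: "R \<ge> 0" "\<And>x. \<phi> x \<noteq> 0 \<Longrightarrow> \<bar>x\<bar> \<le> R"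
    using interpolating_support_bound[OF \<phi>] by blast
  define N where "N = {-\<lceil>R + 1\<rceil>..\<lceil>R + 1\<rceil>}"
  define K :: "(int ^ 'n) set" where "K = vec_lambda ` PiE UNIV (\<lambda>_. N)"
  show thesis
  proof
    show "finite K" unfolding K_def N_def by (intro finite_imageI finite_PiE) auto
    have "(\<chi> i. 0) \<in> K" unfolding K_def N_def using R(1) by (intro imageI) (auto, linarith)
    then show "0 \<in> K" by (simp add: zero_vec_def)
    fix y :: "real ^ 'n" and k assume y: "norm y \<le> 1" and k: "k \<notin> K"
    have "\<exists>i. k $ i \<notin> N"
    proof (rule ccontr)
      assume "\<not> ?thesis"
      then have "vec_nth k \<in> PiE UNIV (\<lambda>_. N)" by auto
      then have "vec_lambda (vec_nth k) \<in> K" unfolding K_def by (rule imageI)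
      then show False using k by simp
    qed
    then obtain i where i: "k $ i \<notin> N" ..
    have "\<bar>y $ i\<bar> \<le> 1" using component_le_norm_cart[of y i] y by linarith
    moreover have "\<bar>of_int (k $ i)\<bar> > R + 1" using i unfolding N_def by auto linarith+
    ultimately have "\<phi> (y $ i - of_int (k $ i)) = 0"
      using R(2)[of "y $ i - of_int (k $ i)"] by linarith
    then show "tensor_power \<phi> (y - int_vec k) = 0"
      by (auto simp: tensor_power_def int_vec_def)
  qed
qed

lemma in_all_scaling_spaces_constant:
  fixes \<phi> :: "real \<Rightarrow> 'k::real_normed_field" and f :: "real ^ 'n::finite \<Rightarrow> 'k"
  assumes \<phi>: "interpolating_mother_scaling \<phi>"
    and f: "\<And>j. f \<in> scaling_space (tensor_power \<phi>) j"
  shows "f x = f 0"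
proof -
  let ?\<Phi> = "tensor_power \<phi> :: real ^ 'n \<Rightarrow> 'k"
  have "\<forall>j. \<exists>a. bounded (range a) \<and> (\<forall>x. f x = (\<Sum>\<^sub>\<infinity>k. a k * ?\<Phi> ((2 powi j) *\<^sub>R x - int_vec k)))"
    using f unfolding scaling_space_def by fast
  then obtain a where bdd: "\<And>j. bounded (range (a j))"
    and rep: "\<And>j x. f x = (\<Sum>\<^sub>\<infinity>k. a j k * ?\<Phi> ((2 powi j) *\<^sub>R x - int_vec k))"
    by metis
  note sample = coefficient_eq_sample[OF \<phi> rep]
  obtain M where M: "\<And>k. norm (a 0 k) \<le> M"
    using bdd[of 0] unfolding bounded_iff by blast
  have coeff_bound: "norm (a (- int m) k) \<le> M" for m k
  proof -
    \<comment> \<open>The sample point \<open>2^m * k\<close> is itself an integer point.\<close>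
    have "(2 powi (- (- int m))) *\<^sub>R int_vec k = int_vec (\<chi> i. 2^m * k $ i)"
      by (simp add: int_vec_def vec_eq_iff)
    then have "a (- int m) k = a 0 (\<chi> i. 2^m * k $ i)"
      using sample[of "- int m" k] sample[of 0 "\<chi> i. 2^m * k $ i"] by simp
    then show ?thesis using M by metis
  qed
  have int_vec_0: "int_vec 0 = (0 :: real ^ 'n)" by (simp add: int_vec_def vec_eq_iff)
  have coeff_0: "a (- int m) 0 = f 0" for m
    using sample[of "- int m" 0] by (simp add: int_vec_0)
  obtain K :: "(int ^ 'n) set" where K: "finite K" "0 \<in> K"
    "\<And>y k. norm y \<le> 1 \<Longrightarrow> k \<notin> K \<Longrightarrow> ?\<Phi> (y - int_vec k) = 0"
    using finite_shifts_near_0[OF \<phi>] by blast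
  define y where "y m = (2 powi (- int m)) *\<^sub>R x" for m
  define \<delta> :: "int ^ 'n \<Rightarrow> 'k" where "\<delta> k = (if k = 0 then 1 else 0)" for k
  define err where "err m = (\<Sum>k\<in>K. M * norm (?\<Phi> (y m - int_vec k) - \<delta> k))" for m
  have "(\<lambda>m. (1/2::real)^m *\<^sub>R x) \<longlonglongrightarrow> 0 *\<^sub>R x"
    by (intro tendsto_intros LIMSEQ_power_zero) auto
  then have y0: "y \<longlonglongrightarrow> 0"
    unfolding y_def by (simp add: power_int_minus power_one_over inverse_eq_divide)
  have "(\<lambda>m. ?\<Phi> (y m - int_vec k)) \<longlonglongrightarrow> \<delta> k" for k
  proof -
    have "(\<lambda>m. y m - int_vec k) \<longlonglongrightarrow> 0 - int_vec k"
      by (intro tendsto_intros y0)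
    moreover have "0 - int_vec k = (int_vec (- k) :: real ^ 'n)"
      by (simp add: int_vec_def vec_eq_iff)
    ultimately have "(\<lambda>m. ?\<Phi> (y m - int_vec k)) \<longlonglongrightarrow> ?\<Phi> (int_vec (- k))"
      using isCont_tendsto_compose[OF continuous_tensor_power[OF \<phi>]] by metis
    then show ?thesis by (simp add: tensor_power_int_vec[OF \<phi>] \<delta>_def)
  qed
  then have "err \<longlonglongrightarrow> (\<Sum>k\<in>K. M * norm (\<delta> k - \<delta> k))"
    unfolding err_def by (intro tendsto_intros)
  then have err0: "err \<longlonglongrightarrow> 0" by simp
  have "eventually (\<lambda>m. norm (y m) < 1) sequentially"
    using order_tendstoD(2)[OF tendsto_norm[OF y0], of 1] by simp
  then have "eventually (\<lambda>m. norm (f x - f 0) \<le> err m) sequentially"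
  proof eventually_elim
    case (elim m)
    have "f x = (\<Sum>\<^sub>\<infinity>k. a (- int m) k * ?\<Phi> (y m - int_vec k))"
      using rep[of x "- int m"] by (simp add: y_def)
    also have "\<dots> = (\<Sum>\<^sub>\<infinity>k\<in>K. a (- int m) k * ?\<Phi> (y m - int_vec k))"
      using elim K(3) by (intro infsum_cong_neutral) auto
    finally have fx: "f x = (\<Sum>k\<in>K. a (- int m) k * ?\<Phi> (y m - int_vec k))"
      using K(1) by simp
    have "(\<Sum>k\<in>K. a (- int m) k * \<delta> k) = (\<Sum>k\<in>K. if k = 0 then f 0 else 0)"
      by (intro sum.cong) (auto simp: \<delta>_def coeff_0)
    then have f0: "f 0 = (\<Sum>k\<in>K. a (- int m) k * \<delta> k)"
      using K(1,2) by simp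
    have "norm (f x - f 0) = norm (\<Sum>k\<in>K. a (- int m) k * (?\<Phi> (y m - int_vec k) - \<delta> k))"
      by (subst fx, subst f0) (simp add: sum_subtractf right_diff_distrib)
    also have "\<dots> \<le> err m"
      unfolding err_def
      by (rule sum_norm_le) (simp add: norm_mult mult_right_mono coeff_bound)
    finally show ?case .
  qed
  then have "norm (f x - f 0) \<le> 0"
    by (rule tendsto_lowerbound[OF err0 _ sequentially_bot])
  then show ?thesis by simp
qed

lemma Inter_scaling_space:
  fixes \<phi> :: "real \<Rightarrow> 'k::real_normed_field"
  assumes "interpolating_mother_scaling \<phi>"
  shows "(\<Inter>j::int. scaling_space (tensor_power \<phi> :: real ^ 'n::finite \<Rightarrow> 'k) j)
    = {(\<lambda>x. c) | c. True}"
proof (intro equalityI subsetI)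
  fix f :: "real ^ 'n \<Rightarrow> 'k" assume "f \<in> (\<Inter>j. scaling_space (tensor_power \<phi>) j)"
  then have "f = (\<lambda>x. f 0)"
    using in_all_scaling_spaces_constant[OF assms] by blast
  then show "f \<in> {(\<lambda>x. c) | c. True}" by blast
next
  fix f :: "real ^ 'n \<Rightarrow> 'k" assume "f \<in> {(\<lambda>x. c) | c. True}"
  then show "f \<in> (\<Inter>j. scaling_space (tensor_power \<phi>) j)"
    using constant_in_scaling_space[OF assms] by blast
qed

theorem theorem6p5:
  fixes \<phi> :: "real \<Rightarrow> real" and \<psi> :: "real \<Rightarrow> complex"
  shows "(interpolating_mother_scaling \<phi> \<longrightarrow>
            (\<Inter>j::int. scaling_space (tensor_power \<phi> :: real ^ 'n::finite \<Rightarrow> real) j)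
              = {(\<lambda>x. c) | c. True})
       \<and> (interpolating_mother_scaling \<psi> \<longrightarrow>
            (\<Inter>j::int. scaling_space (tensor_power \<psi> :: real ^ 'n::finite \<Rightarrow> complex) j)
              = {(\<lambda>x. c) | c. True})"
  by (intro conjI impI Inter_scaling_space)

end
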